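(* The operation $f\mapsto f^{\mathcal D}$ is an interior operator on the (strong) Weihrauch lattice. That is, for all problems $f,g$: (1) $f^{\mathcal D}\leq_{\mathrm{sW}}f$; (2) $f\leq_{\mathrm{sW}}g$ implies $f^{\mathcal D}\leq_{\mathrm{sW}}g^{\mathcal D}$; (3) $f^{\mathcal D}\leq_{\mathrm{sW}}f^{\mathcal D\mathcal D}$, where $f^{\mathcal D\mathcal D}=(f^{\mathcal D})^{\mathcal D}$. Analogous statements hold with $\leq_{\mathrm{sW}}$ replaced throughout by any of $\leq_{\mathrm W}$, $\leq_{\mathrm W}^*$, $\leq_{\mathrm{sW}}^*$.
   Context: A represented space is a set $X$ with a partial surjective map $\delta_X:\subseteq\mathbb N^{\mathbb N}\to X$. A problem is a partial multi-valued function $f:\subseteq X\rightrightarrows Y$ between represented spaces that has a realizer; a realizer of $f$ is a function $F:\subseteq\mathbb N^{\mathbb N}\to\mathbb N^{\mathbb N}$ with $\delta_YF(p)\in f\delta_X(p)$ for all $p\in\mathrm{dom}(f\delta_X)$. For $p,q\in\mathbb N^{\mathbb N}$, $\langle p,q\rangle(2n)=p(n)$, $\langle p,q\rangle(2n+1)=q(n)$. For problems $f,g$: $f\leq_{\mathrm W}g$ if there are computable $H,K:\subseteq\mathbb N^{\mathbb N}\to\mathbb N^{\mathbb N}$ such that $H\langle\mathrm{id},GK\rangle$ is a realizer of $f$ whenever $G$ is a realizer of $g$; $f\leq_{\mathrm{sW}}g$ is defined likewise with $HGK$ instead of $H\langle\mathrm{id},GK\rangle$. $\leq_{\mathrm W}^*$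 and $\leq_{\mathrm{sW}}^*$ are defined likewise with continuous instead of computable $H,K$. $\mathcal D$ is the set of Turing degrees $\deg_{\mathrm T}(p)=\{q\in\mathbb N^{\mathbb N}:q\equiv_{\mathrm T}p\}$, represented by $\delta_{\mathcal D}:\mathbb N^{\mathbb N}\to\mathcal D$, $p\mapsto\deg_{\mathrm T}(p)$. For $y$ in a represented space $(Y,\delta_Y)$ and $q\in\mathbb N^{\mathbb N}$, $y\leq_{\mathrm T}q$ means that some name $p\in\delta_Y^{-1}\{y\}$ satisfies $p\leq_{\mathrm T}q$. The upper Turing cone version of $f:\subseteq X\rightrightarrows Y$ is $f^{\mathcal D}:\subseteq X\rightrightarrows\mathcal D$ with $\mathrm{dom}(f^{\mathcal D})=\mathrm{dom}(f)$ and $f^{\mathcal D}(x)=\{\deg_{\mathrm T}(q):(\exists y\leq_{\mathrm T}q)\ y\in f(x)\}$. *)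

theory Defs
  imports "HOL-Analysis.Function_Topology"
begin

section \<open>Computability on Baire space\<close>

type_synonym baire = "nat \<Rightarrow> nat"

text \<open>
  Computability relative to \<open>p\<close> is Kleene's: the \<open>\<mu>\<close>-recursive functions with \<open>p\<close> as
  an additional initial function. One and the same term is evaluated for every \<open>p\<close>, so terms
  also serve as indices of computable functionals.
\<close>

datatype recf =
    Zero | Succ | Proj nat | Query
  | Comp recf "recf list"
  | Prec recf recf
  | Mu recf

inductive rec_eval :: "baire \<Rightarrow> recf \<Rightarrow> nat list \<Rightarrow> nat \<Rightarrow> bool" for p :: baire where
  zero: "rec_eval p Zero xs 0"
| succ: "rec_eval p Succ [x] (Suc x)"
| proj: "i < length xs \<Longrightarrow> rec_eval p (Proj i) xs (xs ! i)"
| query: "rec_eval p Query [x] (p x)"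
| comp: "list_all2 (\<lambda>h y. rec_eval p h xs y) hs ys \<Longrightarrow> rec_eval p f ys z
    \<Longrightarrow> rec_eval p (Comp f hs) xs z"
| prec_0: "rec_eval p f xs y \<Longrightarrow> rec_eval p (Prec f h) (0 # xs) y"
| prec_Suc: "rec_eval p (Prec f h) (n # xs) y \<Longrightarrow> rec_eval p h (n # y # xs) z
    \<Longrightarrow> rec_eval p (Prec f h) (Suc n # xs) z"
| mu: "rec_eval p f (n # xs) 0 \<Longrightarrow> (\<And>m. m < n \<Longrightarrow> \<exists>y. rec_eval p f (m # xs) (Suc y))
    \<Longrightarrow> rec_eval p (Mu f) xs n"

lemma rec_eval_deterministic:
  "rec_eval p f xs y \<Longrightarrow> rec_eval p f xs z \<Longrightarrow> y = z"
proof (induction arbitrary: z rule: rec_eval.induct)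
  case (comp xs hs ys f u)
  from comp.prems obtain ys' where
    *: "list_all2 (\<lambda>h y. rec_eval p h xs y) hs ys'" "rec_eval p f ys' z"
    by (cases rule: rec_eval.cases) auto
  from comp.IH(1) *(1) have "ys = ys'"
    by (auto simp: list_all2_conv_all_nth intro!: nth_equalityI)
  with comp.IH(2) *(2) show ?case by blast
next
  case (mu f n xs)
  from mu.prems have z: "rec_eval p f (z # xs) 0"
    "\<And>m. m < z \<Longrightarrow> \<exists>y. rec_eval p f (m # xs) (Suc y)"
    by (cases rule: rec_eval.cases; blast)+
  show ?case
  proof (cases n z rule: linorder_cases)
    case less
    with z(2) mu.IH show ?thesis by blast
  next
    case greater
    with z(1) mu.IH show ?thesis by blast
  qed
next
  case (prec_Suc f h n xs y u)
  note IH = prec_Suc.IH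
  from prec_Suc.prems show ?case
  proof (cases rule: rec_eval.cases)
    case (prec_Suc y')
    with IH show ?thesis by blast
  qed
next
  case (prec_0 f xs y h)
  from prec_0.prems show ?case
    by (cases rule: rec_eval.cases) (use prec_0.IH in simp_all)
qed (erule rec_eval.cases; simp)+

definition turing_le :: "baire \<Rightarrow> baire \<Rightarrow> bool" (infix "\<le>\<^sub>T" 50) where
  "p \<le>\<^sub>T q \<longleftrightarrow> (\<exists>e. \<forall>n. rec_eval q e [n] (p n))"

definition turing_equiv :: "baire \<Rightarrow> baire \<Rightarrow> bool" (infix "\<equiv>\<^sub>T" 50) where
  "p \<equiv>\<^sub>T q \<longleftrightarrow> p \<le>\<^sub>T q \<and> q \<le>\<^sub>T p"

lemma turing_le_refl: "p \<le>\<^sub>T p"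
  unfolding turing_le_def by (blast intro: rec_eval.query)

text \<open>
  A partial function counts as computable if it is a restriction of some functional given by a term;
  nothing is required outside the domain.
\<close>

definition computable_pfun :: "(baire \<rightharpoonup> baire) \<Rightarrow> bool" where
  "computable_pfun F \<longleftrightarrow>
     (\<exists>e. \<forall>p q. F p = Some q \<longrightarrow> (\<forall>n. rec_eval p e [n] (q n)))"

text \<open>
  The topology on \<^typ>\<open>baire\<close> is the library's product topology, where \<^typ>\<open>nat\<close> is discrete.
\<close>

definition continuous_pfun :: "(baire \<rightharpoonup> baire) \<Rightarrow> bool" where
  "continuous_pfun F \<longleftrightarrow> continuous_on (dom F) (\<lambda>p. the (F p))"

definition baire_pair :: "baire \<Rightarrow> baire \<Rightarrow> baire" where
  "baire_pair p q n = (if even n then p (n div 2) else q (n div 2))"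


section \<open>Represented spaces and problems\<close>

text \<open>
  A represented space is given by its representation; the underlying set is the range, so that
  surjectivity holds by construction.
\<close>

type_synonym 'x representation = "baire \<rightharpoonup> 'x"

text \<open>
  A partial multi-valued function is bundled with the representations of its source and target.
  As usual, it is a relation between the two spaces, given by its value sets (empty outside of the
  domain).
\<close>

record ('x, 'y) mvfun =
  src :: "'x representation"
  tgt :: "'y representation"
  vals :: "'x \<Rightarrow> 'y set"

definition mdom :: "('x, 'y) mvfun \<Rightarrow> 'x set" where
  "mdom f = {x. vals f x \<noteq> {}}"

definition realizer :: "(baire \<rightharpoonup> baire) \<Rightarrow> ('x, 'y) mvfun \<Rightarrow> bool" where
  "realizer F f \<longleftrightarrow>
     (\<forall>p x. src f p = Some x \<and> x \<in> mdom f \<longrightarrow>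
        (\<exists>q y. F p = Some q \<and> tgt f q = Some y \<and> y \<in> vals f x))"

definition problem :: "('x, 'y) mvfun \<Rightarrow> bool" where
  "problem f \<longleftrightarrow>
     mdom f \<subseteq> ran (src f) \<and> (\<forall>x. vals f x \<subseteq> ran (tgt f)) \<and> (\<exists>F. realizer F f)"


section \<open>Weihrauch reducibility\<close>

definition W_le_via ::
  "((baire \<rightharpoonup> baire) \<Rightarrow> bool) \<Rightarrow> ('a, 'b) mvfun \<Rightarrow> ('c, 'd) mvfun \<Rightarrow> bool" where
  "W_le_via P f g \<longleftrightarrow>
     (\<exists>H K. P H \<and> P K \<and>
        (\<forall>G. realizer G g \<longrightarrow>
           realizer (H \<circ>\<^sub>m (\<lambda>p. map_option (baire_pair p) ((G \<circ>\<^sub>m K) p))) f))"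

definition sW_le_via ::
  "((baire \<rightharpoonup> baire) \<Rightarrow> bool) \<Rightarrow> ('a, 'b) mvfun \<Rightarrow> ('c, 'd) mvfun \<Rightarrow> bool" where
  "sW_le_via P f g \<longleftrightarrow>
     (\<exists>H K. P H \<and> P K \<and> (\<forall>G. realizer G g \<longrightarrow> realizer (H \<circ>\<^sub>m G \<circ>\<^sub>m K) f))"

definition W_le :: "('a, 'b) mvfun \<Rightarrow> ('c, 'd) mvfun \<Rightarrow> bool" (infix "\<le>\<^sub>W" 50) where
  "f \<le>\<^sub>W g \<longleftrightarrow> W_le_via computable_pfun f g"

definition sW_le :: "('a, 'b) mvfun \<Rightarrow> ('c, 'd) mvfun \<Rightarrow> bool" (infix "\<le>\<^sub>s\<^sub>W" 50) where
  "f \<le>\<^sub>s\<^sub>W g \<longleftrightarrow> sW_le_via computable_pfun f g"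

definition W_le_cont :: "('a, 'b) mvfun \<Rightarrow> ('c, 'd) mvfun \<Rightarrow> bool" (infix "\<le>\<^sub>W\<^sup>*" 50) where
  "f \<le>\<^sub>W\<^sup>* g \<longleftrightarrow> W_le_via continuous_pfun f g"

definition sW_le_cont :: "('a, 'b) mvfun \<Rightarrow> ('c, 'd) mvfun \<Rightarrow> bool" (infix "\<le>\<^sub>s\<^sub>W\<^sup>*" 50) where
  "f \<le>\<^sub>s\<^sub>W\<^sup>* g \<longleftrightarrow> sW_le_via continuous_pfun f g"


section \<open>The upper Turing cone version of a problem\<close>

definition turing_deg :: "baire \<Rightarrow> baire set" where
  "turing_deg p = {q. q \<equiv>\<^sub>T p}"

definition deg_rep :: "baire set representation" where
  "deg_rep p = Some (turing_deg p)"

definition point_turing_le :: "'y representation \<Rightarrow> 'y \<Rightarrow> baire \<Rightarrow> bool" where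
  "point_turing_le \<delta> y q \<longleftrightarrow> (\<exists>p. \<delta> p = Some y \<and> p \<le>\<^sub>T q)"

definition upper_cone :: "('x, 'y) mvfun \<Rightarrow> ('x, baire set) mvfun" ("_\<^sup>\<D>" [1000] 1000) where
  "f\<^sup>\<D> = \<lparr>src = src f, tgt = deg_rep,
     vals = (\<lambda>x. {turing_deg q | q. \<exists>y. point_turing_le (tgt f) y q \<and> y \<in> vals f x})\<rparr>"

lemma mdom_upper_cone:
  assumes "problem f"
  shows "mdom (f\<^sup>\<D>) = mdom f"
proof -
  have "\<exists>q. point_turing_le (tgt f) y q" if "y \<in> vals f x" for x y
    using assms that turing_le_refl by (force simp: problem_def point_turing_le_def ran_def)
  then show ?thesis
    by (auto simp: mdom_def upper_cone_def)
qed

lemma problem_upper_cone: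
  assumes "problem f"
  shows "problem (f\<^sup>\<D>)"
proof -
  from assms obtain F where F: "realizer F f"
    by (auto simp: problem_def)
  have "realizer F (f\<^sup>\<D>)"
    unfolding realizer_def mdom_upper_cone[OF assms]
  proof (intro allI impI)
    fix p x assume "src (f\<^sup>\<D>) p = Some x \<and> x \<in> mdom f"
    then obtain q y where "F p = Some q" "tgt f q = Some y" "y \<in> vals f x"
      using F unfolding realizer_def upper_cone_def mvfun.simps by blast
    then show "\<exists>q d. F p = Some q \<and> tgt (f\<^sup>\<D>) q = Some d \<and> d \<in> vals (f\<^sup>\<D>) x"
      using turing_le_refl by (auto simp: upper_cone_def deg_rep_def point_turing_le_def)
  qed
  moreover have "mdom (f\<^sup>\<D>) \<subseteq> ran (src (f\<^sup>\<D>))"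
    using assms unfolding mdom_upper_cone[OF assms] by (simp add: problem_def upper_cone_def)
  moreover have "vals (f\<^sup>\<D>) x \<subseteq> ran (tgt (f\<^sup>\<D>))" for x
    by (auto simp: upper_cone_def deg_rep_def ran_def)
  ultimately show ?thesis
    by (auto simp: problem_def)
qed

end

theory Submission
  imports Defs "HOL-Library.Nat_Bijection"
begin

text \<open>
  Every realizer of \<open>f\<close> realizes \<open>f\<^sup>\<D>\<close>, and by transitivity of Turing reducibility every
  realizer of \<open>(f\<^sup>\<D>)\<^sup>\<D>\<close> realizes \<open>f\<^sup>\<D>\<close>. For monotonicity, let \<open>f\<close> be reduced to \<open>g\<close> by
  \<open>H\<close> and \<open>K\<close>, and let \<open>G\<close> realize \<open>g\<^sup>\<D>\<close>. Choosing for each name \<open>k\<close> of an instance of \<open>g\<close> a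
  name of a solution that is Turing below \<open>G k\<close> gives a realizer \<open>G'\<close> of \<open>g\<close>. If \<open>H\<close> is
  computable, the solution \<open>H (G' (K p))\<close> lies Turing below \<open>G (K p)\<close>, hence the identity can
  replace \<open>H\<close>. If \<open>H\<close> is only continuous, it is computable relative to some oracle \<open>s\<close>, and
  \<open>q \<mapsto> \<langle>s, q\<rangle>\<close> can replace \<open>H\<close>.
\<close>

section \<open>Recursive terms\<close>

lemma rec_eval_Proj: "i < length xs \<Longrightarrow> xs ! i = y \<Longrightarrow> rec_eval p (Proj i) xs y"
  using rec_eval.proj by blast

lemma rec_eval_Comp1:
  "rec_eval p h xs a \<Longrightarrow> rec_eval p f [a] z \<Longrightarrow> rec_eval p (Comp f [h]) xs z"
  by (rule rec_eval.comp[where ys = "[a]"]) auto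

lemma rec_eval_Comp2:
  "rec_eval p h xs a \<Longrightarrow> rec_eval p h' xs b \<Longrightarrow> rec_eval p f [a, b] z
    \<Longrightarrow> rec_eval p (Comp f [h, h']) xs z"
  by (rule rec_eval.comp[where ys = "[a, b]"]) auto

lemma rec_eval_Comp3:
  "rec_eval p h xs a \<Longrightarrow> rec_eval p h' xs b \<Longrightarrow> rec_eval p h'' xs c \<Longrightarrow> rec_eval p f [a, b, c] z
    \<Longrightarrow> rec_eval p (Comp f [h, h', h'']) xs z"
  by (rule rec_eval.comp[where ys = "[a, b, c]"]) auto

lemma rec_eval_Prec:
  assumes "rec_eval p f xs (r 0)" and "\<And>n. rec_eval p h (n # r n # xs) (r (Suc n))"
  shows "rec_eval p (Prec f h) (n # xs) (r n)"
  by (induction n) (auto intro: rec_eval.prec_0 rec_eval.prec_Suc assms)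

text \<open>A \<open>Prec\<close> term recurses on its first argument; its step term receives the
  counter, the previous value and then the parameters, so \<open>Proj 1\<close> in a step is the
  previous value.\<close>

definition "add_rec = Prec (Proj 0) (Comp Succ [Proj 1])"
definition "odd_rec = Comp Succ [Comp add_rec [Proj 0, Proj 0]]"
definition "triangle_rec = Prec Zero (Comp Succ [Comp add_rec [Proj 1, Proj 0]])"
text \<open>Cantor's pairing \<open>triangle (m + n) + m\<close>, the formula behind
  \<open>prod_encode\<close>.\<close>

definition "pair_rec = Comp add_rec [Comp triangle_rec [add_rec], Proj 0]"
definition "is_zero_rec = Prec (Comp Succ [Zero]) Zero"
definition "mod2_rec = Prec Zero (Comp is_zero_rec [Proj 1])"
definition "div2_rec = Prec Zero (Comp add_rec [Proj 1, Comp mod2_rec [Proj 0]])"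
text \<open>The step sees the counter, the previous value, a and b, so \<open>Proj 3\<close> yields
  b for every positive n.\<close>

definition "if_zero_rec = Prec (Proj 0) (Proj 3)"
definition "pred_rec = Prec Zero (Proj 0)"

lemma rec_eval_add: "rec_eval p add_rec [m, n] (m + n)"
  unfolding add_rec_def
  by (rule rec_eval_Prec) (auto intro!: rec_eval_Proj rec_eval_Comp1 rec_eval.succ)

lemma rec_eval_double: "rec_eval p (Comp add_rec [Proj 0, Proj 0]) [n] (2 * n)"
  unfolding mult_2
  by (rule rec_eval_Comp2) (auto intro!: rec_eval_Proj rec_eval_add)

lemma rec_eval_odd: "rec_eval p odd_rec [n] (Suc (2 * n))"
  unfolding odd_rec_def
  by (rule rec_eval_Comp1[OF rec_eval_double rec_eval.succ])

lemma rec_eval_triangle: "rec_eval p triangle_rec [n] (triangle n)"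
  unfolding triangle_rec_def
  by (rule rec_eval_Prec)
    (auto intro!: rec_eval.zero rec_eval_Comp1 rec_eval_Comp2 rec_eval_Proj rec_eval_add rec_eval.succ)

lemma rec_eval_pair: "rec_eval p pair_rec [m, n] (prod_encode (m, n))"
  unfolding pair_rec_def prod_encode_def
  by (auto intro!: rec_eval_Comp1 rec_eval_Comp2 rec_eval_Proj rec_eval_triangle rec_eval_add)

lemma rec_eval_is_zero: "rec_eval p is_zero_rec [n] (of_bool (n = 0))"
  unfolding is_zero_rec_def
  by (rule rec_eval_Prec) (use rec_eval.zero rec_eval.succ rec_eval_Comp1 in fastforce)+

lemma rec_eval_mod2: "rec_eval p mod2_rec [n] (n mod 2)"
  unfolding mod2_rec_def
proof (rule rec_eval_Prec)
  fix n
  have "Suc n mod 2 = of_bool (n mod 2 = 0)"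
    by (simp add: mod2_eq_if)
  then show "rec_eval p (Comp is_zero_rec [Proj 1]) [n, n mod 2] (Suc n mod 2)"
    by (simp only:) (rule rec_eval_Comp1[OF rec_eval_Proj rec_eval_is_zero], simp_all)
qed (auto intro: rec_eval.zero)

lemma rec_eval_div2: "rec_eval p div2_rec [n] (n div 2)"
  unfolding div2_rec_def
proof (rule rec_eval_Prec)
  fix n
  have "Suc n div 2 = n div 2 + n mod 2"
    by presburger
  then show "rec_eval p (Comp add_rec [Proj 1, Comp mod2_rec [Proj 0]]) [n, n div 2] (Suc n div 2)"
    by (auto intro!: rec_eval_Comp1 rec_eval_Comp2 rec_eval_Proj rec_eval_mod2 rec_eval_add)
qed (auto intro: rec_eval.zero)

lemma rec_eval_if_zero: "rec_eval p if_zero_rec [n, a, b] (if n = 0 then a else b)"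
  unfolding if_zero_rec_def
  by (rule rec_eval_Prec) (auto intro!: rec_eval_Proj)

lemma rec_eval_pred: "rec_eval p pred_rec [n] (n - 1)"
  unfolding pred_rec_def
  by (rule rec_eval_Prec) (auto intro!: rec_eval_Proj rec_eval.zero)

section \<open>Turing reducibility\<close>

text \<open>Each oracle call becomes a computation of its answer by \<open>e\<close>. This composes
  two reductions and so gives transitivity.\<close>

primrec subst_query :: "recf \<Rightarrow> recf \<Rightarrow> recf" where
  "subst_query e Zero = Zero"
| "subst_query e Succ = Succ"
| "subst_query e (Proj i) = Proj i"
| "subst_query e Query = e"
| "subst_query e (Comp f hs) = Comp (subst_query e f) (map (subst_query e) hs)"
| "subst_query e (Prec f h) = Prec (subst_query e f) (subst_query e h)"
| "subst_query e (Mu f) = Mu (subst_query e f)"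

lemma rec_eval_subst_query:
  assumes "rec_eval p t xs y" and e: "\<And>n. rec_eval q e [n] (p n)"
  shows "rec_eval q (subst_query e t) xs y"
  using assms(1)
proof (induction rule: rec_eval.induct)
  case (comp xs hs ys f z)
  then have "list_all2 (\<lambda>h y. rec_eval q h xs y) (map (subst_query e) hs) ys"
    by (simp add: list_all2_conv_all_nth)
  from rec_eval.comp[OF this comp.IH(2)] show ?case
    by simp
next
  case (mu f n xs)
  then have "rec_eval q (Mu (subst_query e f)) xs n"
    by (intro rec_eval.mu) blast+
  then show ?case
    by simp
next
  case (prec_Suc f h n xs y z)
  then show ?case
    by simp (rule rec_eval.prec_Suc)
qed (simp_all add: e rec_eval.zero rec_eval.succ rec_eval.proj rec_eval.prec_0)

lemma turing_le_trans: "p \<le>\<^sub>T q \<Longrightarrow> q \<le>\<^sub>T r \<Longrightarrow> p \<le>\<^sub>T r"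
  unfolding turing_le_def using rec_eval_subst_query by meson

lemma rec_eval_baire_pair_snd:
  "rec_eval (baire_pair p q) (Comp Query [odd_rec]) [n] (q n)"
  using rec_eval_Comp1[OF rec_eval_odd rec_eval.query, of "baire_pair p q" n]
  by (simp add: baire_pair_def)

lemma rec_eval_baire_pair_fst:
  "rec_eval (baire_pair p q) (Comp Query [Comp add_rec [Proj 0, Proj 0]]) [n] (p n)"
  using rec_eval_Comp1[OF rec_eval_double rec_eval.query, of "baire_pair p q" n]
  by (simp add: baire_pair_def)

lemma turing_le_baire_pair:
  "p \<le>\<^sub>T baire_pair p q" "q \<le>\<^sub>T baire_pair p q"
  unfolding turing_le_def using rec_eval_baire_pair_fst rec_eval_baire_pair_snd by blast+

lemma baire_pair_turing_le:
  assumes "p \<le>\<^sub>T r" and "q \<le>\<^sub>T r"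
  shows "baire_pair p q \<le>\<^sub>T r"
proof -
  obtain a b where a: "\<And>n. rec_eval r a [n] (p n)" and b: "\<And>n. rec_eval r b [n] (q n)"
    using assms unfolding turing_le_def by blast
  have "rec_eval r (Comp if_zero_rec [mod2_rec, Comp a [div2_rec], Comp b [div2_rec]]) [n]
      (baire_pair p q n)" for n
    unfolding baire_pair_def even_iff_mod_2_eq_zero
    by (rule rec_eval_Comp3[OF rec_eval_mod2 rec_eval_Comp1[OF rec_eval_div2 a]
          rec_eval_Comp1[OF rec_eval_div2 b] rec_eval_if_zero])
  then show ?thesis
    unfolding turing_le_def by blast
qed

lemma baire_pair_turing_mono: "q \<le>\<^sub>T r \<Longrightarrow> baire_pair p q \<le>\<^sub>T baire_pair p r"
  by (blast intro: baire_pair_turing_le turing_le_baire_pair turing_le_trans)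

lemma turing_deg_eqD: "turing_deg p = turing_deg q \<Longrightarrow> p \<le>\<^sub>T q"
  using turing_le_refl by (auto simp: turing_deg_def turing_equiv_def)

section \<open>Continuous functions are computable relative to an oracle\<close>

text \<open>The reversal puts the newest value at the head of the list, so lengthening the prefix by
  one is a single \<open>Suc (prod_encode ...)\<close>, as primitive recursion requires.\<close>

definition prefix_code :: "baire \<Rightarrow> nat \<Rightarrow> nat" where
  "prefix_code p k = list_encode (rev (map p [0..<k]))"

lemma prefix_code_eq_iff: "prefix_code p k = prefix_code q l \<longleftrightarrow> k = l \<and> (\<forall>i<k. p i = q i)"
proof -
  have "map p [0..<k] = map q [0..<l] \<longleftrightarrow> k = l \<and> (\<forall>i<k. p i = q i)"
    by (auto simp: list_eq_iff_nth_eq)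
  then show ?thesis
    by (simp only: prefix_code_def list_encode_eq rev_is_rev_conv)
qed

definition "prefix_code_rec e = Prec Zero (Comp Succ [Comp pair_rec [Comp e [Proj 0], Proj 1]])"

lemma rec_eval_prefix_code:
  assumes "\<And>n. rec_eval r e [n] (p n)"
  shows "rec_eval r (prefix_code_rec e) [k] (prefix_code p k)"
  unfolding prefix_code_rec_def
proof (rule rec_eval_Prec)
  fix n
  have "prefix_code p (Suc n) = Suc (prod_encode (p n, prefix_code p n))"
    by (simp add: prefix_code_def)
  then show "rec_eval r (Comp Succ [Comp pair_rec [Comp e [Proj 0], Proj 1]])
      [n, prefix_code p n] (prefix_code p (Suc n))"
    by (auto intro!: rec_eval_Comp1 rec_eval_Comp2 rec_eval_Proj rec_eval_pair rec_eval.succ assms)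
qed (simp add: prefix_code_def rec_eval.zero)

text \<open>A basic open box around p restricts only finitely many coordinates; any strict bound k
  on their indices will do.\<close>

lemma open_contains_prefix_cylinder:
  fixes U :: "baire set"
  assumes "open U" and "p \<in> U"
  shows "\<exists>k. {q. \<forall>i<k. q i = p i} \<subseteq> U"
proof -
  obtain X where X: "p \<in> Pi\<^sub>E UNIV X" "finite {i. X i \<noteq> UNIV}" "Pi\<^sub>E UNIV X \<subseteq> U"
    using product_topology_open_contains_basis[of "\<lambda>_. euclidean" UNIV U p] assms
    by (auto simp: open_fun_def)
  obtain k where k: "\<And>i. X i \<noteq> UNIV \<Longrightarrow> i < k"
    using X(2) finite_nat_set_iff_bounded by auto
  have "q \<in> Pi\<^sub>E UNIV X" if "\<forall>i<k. q i = p i" for q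
    using X(1) k that by (auto simp: PiE_iff) (metis UNIV_I)
  with X(3) show ?thesis
    by blast
qed

text \<open>Since \<open>{z n}\<close> is open in the discrete space, its preimage under the n-th
  output coordinate is relatively open in \<open>dom H\<close>. The length k may depend on
  n.\<close>

lemma continuous_pfun_local_const:
  assumes "continuous_pfun H" and "H p = Some z"
  shows "\<exists>k. \<forall>q w. H q = Some w \<longrightarrow> (\<forall>i<k. q i = p i) \<longrightarrow> w n = z n"
proof -
  have "continuous_on (dom H) (\<lambda>p. the (H p) n)"
    using assms(1) unfolding continuous_pfun_def
    by (rule continuous_on_product_then_coordinatewise)
  moreover have "open {z n}"
    by (rule open_discrete)
  ultimately obtain U where U: "open U" "U \<inter> dom H = (\<lambda>p. the (H p) n) -` {z n} \<inter> dom H"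
    unfolding continuous_on_open_invariant by blast
  with assms(2) have "p \<in> U"
    by auto
  then obtain k where k: "{q. \<forall>i<k. q i = p i} \<subseteq> U"
    using open_contains_prefix_cylinder U(1) by blast
  have "w n = z n" if w: "H q = Some w" and "\<forall>i<k. q i = p i" for q w
  proof -
    have "q \<in> U \<inter> dom H"
      using k that by blast
    then show ?thesis
      unfolding U(2) by (simp add: w)
  qed
  then show ?thesis
    by blast
qed

text \<open>The oracle s is a table, the same for all p, of the output values forced by finite
  prefixes of the input. To find \<open>z n\<close>, search for the first prefix of p with a nonzero
  entry; continuity makes the search stop.\<close>

lemma continuous_pfun_turing_le:
  assumes "continuous_pfun H"
  obtains s where "\<And>p z. H p = Some z \<Longrightarrow> z \<le>\<^sub>T baire_pair s p"
proof -
  \<comment> \<open>The prefix with code c forces the output v at place n throughout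
    \<open>dom H\<close>.\<close>
  define D where "D c n v \<longleftrightarrow> (\<forall>q w k. H q = Some w \<longrightarrow> prefix_code q k = c \<longrightarrow> w n = v)"
    for c n v
  \<comment> \<open>The entry 0 means that nothing is forced, hence the shift of forced values by
    one. For a prefix that no point of \<open>dom H\<close> extends, every v is forced and the entry
    is arbitrary.\<close>
  define s where "s i = (case prod_decode i of (c, n) \<Rightarrow>
      if \<exists>v. D c n v then Suc (SOME v. D c n v) else 0)" for i
  \<comment> \<open>On \<open>[k, n]\<close>, the prefix of p is computed from the odd half of the
    oracle, and its entry is read from s in the even half.\<close>
  define look where "look = Comp (Comp Query [Comp add_rec [Proj 0, Proj 0]])
      [Comp pair_rec [Comp (prefix_code_rec (Comp Query [odd_rec])) [Proj 0], Proj 1]]"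
  \<comment> \<open>\<open>Mu\<close> searches for a zero, so \<open>is_zero_rec\<close> turns
    nonzero entries into targets; \<open>pred_rec\<close> undoes the shift.\<close>
  define e where "e = Comp pred_rec [Comp look [Mu (Comp is_zero_rec [look]), Proj 0]]"
  have "rec_eval (baire_pair s p) e [n] (z n)" if z: "H p = Some z" for p z n
  proof -
    let ?s = "\<lambda>k. s (prod_encode (prefix_code p k, n))"
    have look: "rec_eval (baire_pair s p) look [k, n] (?s k)" for k
      unfolding look_def
    proof (rule rec_eval_Comp1[OF rec_eval_Comp2[OF _ _ rec_eval_pair] rec_eval_baire_pair_fst])
      show "rec_eval (baire_pair s p) (Comp (prefix_code_rec (Comp Query [odd_rec])) [Proj 0]) [k, n]
          (prefix_code p k)"
        by (rule rec_eval_Comp1[OF rec_eval_Proj rec_eval_prefix_code[OF rec_eval_baire_pair_snd]])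
          simp_all
      show "rec_eval (baire_pair s p) (Proj 1) [k, n] n"
        by (rule rec_eval_Proj) simp_all
    qed
    \<comment> \<open>The point p extends its own prefixes, so these force no value but the true
      one.\<close>
    have D: "v = z n" if "D (prefix_code p k) n v" for k v
      using that z unfolding D_def by blast
    obtain k where "\<forall>q w. H q = Some w \<longrightarrow> (\<forall>i<k. q i = p i) \<longrightarrow> w n = z n"
      using continuous_pfun_local_const[OF assms z] by blast
    then have "D (prefix_code p k) n (z n)"
      by (auto simp: D_def prefix_code_eq_iff)
    then have ex: "?s k \<noteq> 0"
      by (auto simp: s_def)
    \<comment> \<open>The search may stop before the k given by continuity, but by \<open>D\<close>
      the entry found there is still correct.\<close>
    define m where "m = (LEAST k. ?s k \<noteq> 0)"
    have less: "?s i = 0" if "i < m" for i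
      using not_less_Least[of i "\<lambda>k. ?s k \<noteq> 0"] that unfolding m_def by blast
    have "?s m \<noteq> 0"
      using LeastI[of "\<lambda>k. ?s k \<noteq> 0", OF ex] unfolding m_def .
    then have val: "?s m = Suc (z n)"
      using D by (auto simp: s_def split: if_splits intro: someI2)
    have test: "rec_eval (baire_pair s p) (Comp is_zero_rec [look]) [k, n] (of_bool (?s k = 0))" for k
      by (rule rec_eval_Comp1[OF look rec_eval_is_zero])
    have "rec_eval (baire_pair s p) (Mu (Comp is_zero_rec [look])) [n] m"
    proof (rule rec_eval.mu)
      show "rec_eval (baire_pair s p) (Comp is_zero_rec [look]) [m, n] 0"
        using test[of m] val by simp
      show "\<exists>y. rec_eval (baire_pair s p) (Comp is_zero_rec [look]) [i, n] (Suc y)" if "i < m" for i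
        using test[of i] less[OF that] by auto
    qed
    then have "rec_eval (baire_pair s p) e [n] (?s m - 1)"
      unfolding e_def
      by (auto intro!: rec_eval_Comp1[OF _ rec_eval_pred[unfolded One_nat_def]] rec_eval_Comp2
          rec_eval_Proj look)
    then show ?thesis
      by (simp add: val)
  qed
  then show thesis
    using that unfolding turing_le_def by blast
qed

section \<open>Operations on computable and on continuous functions\<close>

text \<open>Serves as the outer function of a Weihrauch reduction that forgets the original
  input.\<close>

definition baire_snd :: "baire \<Rightarrow> baire" where
  "baire_snd p n = p (Suc (2 * n))"

lemma baire_snd_pair: "baire_snd (baire_pair p q) = q"
  by (simp add: baire_snd_def baire_pair_def fun_eq_iff)

lemma computable_pfun_Some: "computable_pfun Some"
  unfolding computable_pfun_def using rec_eval.query by auto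

lemma computable_pfun_baire_snd: "computable_pfun (\<lambda>p. Some (baire_snd p))"
  unfolding computable_pfun_def baire_snd_def
  using rec_eval_Comp1[OF rec_eval_odd rec_eval.query] by auto

lemma continuous_pfun_total: "continuous_pfun (\<lambda>p. Some (F p)) \<longleftrightarrow> continuous_on UNIV F"
  by (simp add: continuous_pfun_def dom_def)

lemma continuous_pfun_Some: "continuous_pfun Some"
  by (simp add: continuous_pfun_total)

lemma continuous_pfun_baire_snd: "continuous_pfun (\<lambda>p. Some (baire_snd p))"
  unfolding continuous_pfun_total baire_snd_def
  by (intro continuous_on_coordinatewise_then_product continuous_on_product_coordinates)

lemma continuous_pfun_baire_pair: "continuous_pfun (\<lambda>p. Some (baire_pair s p))"
  unfolding continuous_pfun_total
proof (rule continuous_on_coordinatewise_then_product)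
  show "continuous_on UNIV (\<lambda>p. baire_pair s p n)" for n
    by (cases "even n") (auto simp: baire_pair_def intro: continuous_on_product_coordinates)
qed

section \<open>The upper cone operator\<close>

lemma realizer_mono:
  assumes "realizer F f" and "src g = src f" and "mdom g \<subseteq> mdom f"
    and "\<And>x q y. y \<in> vals f x \<Longrightarrow> tgt f q = Some y \<Longrightarrow> \<exists>y'. tgt g q = Some y' \<and> y' \<in> vals g x"
  shows "realizer F g"
  unfolding realizer_def
proof (intro allI impI)
  fix p x
  assume "src g p = Some x \<and> x \<in> mdom g"
  then have "src f p = Some x" "x \<in> mdom f"
    using assms(2,3) by auto
  then obtain q y where "F p = Some q" "tgt f q = Some y" "y \<in> vals f x"
    using assms(1) unfolding realizer_def by blast
  with assms(4) show "\<exists>q y. F p = Some q \<and> tgt g q = Some y \<and> y \<in> vals g x"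
    by blast
qed

text \<open>A name of a solution computes itself, so its degree lies in the cone.\<close>

lemma realizer_upper_cone:
  assumes "problem f" and "realizer F f"
  shows "realizer F (f\<^sup>\<D>)"
  by (rule realizer_mono[OF assms(2)])
    (auto simp: mdom_upper_cone[OF assms(1)], auto simp: upper_cone_def deg_rep_def
      point_turing_le_def intro: turing_le_refl)

lemma realizer_upper_cone_iterated:
  assumes "problem f" and "realizer F ((f\<^sup>\<D>)\<^sup>\<D>)"
  shows "realizer F (f\<^sup>\<D>)"
proof (rule realizer_mono[OF assms(2)])
  fix x q d
  assume "d \<in> vals ((f\<^sup>\<D>)\<^sup>\<D>) x" and "tgt ((f\<^sup>\<D>)\<^sup>\<D>) q = Some d"
  \<comment> \<open>Degrees fix their names only up to Turing equivalence, hence the chain from p to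
    r, r', q' and finally q.\<close>
  then obtain q' r r' y p where "turing_deg q = turing_deg q'" "r' \<le>\<^sub>T q'"
    "turing_deg r' = turing_deg r" "p \<le>\<^sub>T r" "tgt f p = Some y" "y \<in> vals f x"
    by (auto simp: upper_cone_def deg_rep_def point_turing_le_def)
  moreover from this have "p \<le>\<^sub>T q"
    by (metis turing_deg_eqD turing_le_trans)
  ultimately show "\<exists>d. tgt (f\<^sup>\<D>) q = Some d \<and> d \<in> vals (f\<^sup>\<D>) x"
    by (auto simp: upper_cone_def deg_rep_def point_turing_le_def)
qed (auto simp: mdom_upper_cone[OF problem_upper_cone[OF assms(1)]], simp add: upper_cone_def)

lemma sW_le_via_realizer:
  assumes "P Some" and "\<And>G. realizer G g \<Longrightarrow> realizer G f"
  shows "sW_le_via P f g"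
proof -
  have "Some \<circ>\<^sub>m G \<circ>\<^sub>m Some = G" for G :: "baire \<rightharpoonup> baire"
    by (auto simp: map_comp_def fun_eq_iff split: option.splits)
  with assms show ?thesis
    unfolding sW_le_via_def by metis
qed

text \<open>With K the identity, the projection \<open>baire_snd\<close> recovers the answer of G
  from the pair.\<close>

lemma W_le_via_realizer:
  assumes "P Some" and "P (\<lambda>p. Some (baire_snd p))" and "\<And>G. realizer G g \<Longrightarrow> realizer G f"
  shows "W_le_via P f g"
proof -
  have "(\<lambda>p. Some (baire_snd p)) \<circ>\<^sub>m (\<lambda>p. map_option (baire_pair p) ((G \<circ>\<^sub>m Some) p)) = G" for G
    by (auto simp: map_comp_def fun_eq_iff baire_snd_pair split: option.splits)
  with assms show ?thesis
    unfolding W_le_via_def by metis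
qed

text \<open>
  The parameter \<open>\<phi>\<close> covers both kinds of reducibility: it is \<^const>\<open>baire_pair\<close> for \<open>\<le>\<^sub>W\<close> and
  \<open>\<lambda>p q. q\<close> for \<open>\<le>\<^sub>s\<^sub>W\<close>.
\<close>

lemma realizer_upper_cone_reduction:
  assumes f: "problem f" and g: "problem g" and G: "realizer G (g\<^sup>\<D>)"
    and red: "\<And>G. realizer G g \<Longrightarrow> realizer (H \<circ>\<^sub>m (\<lambda>p. map_option (\<phi> p) ((G \<circ>\<^sub>m K) p))) f"
    and \<phi>: "\<And>p q r. q \<le>\<^sub>T r \<Longrightarrow> \<phi> p q \<le>\<^sub>T \<phi> p r"
    and H': "\<And>q r z. H q = Some z \<Longrightarrow> q \<le>\<^sub>T r \<Longrightarrow> z \<le>\<^sub>T H' r"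
  shows "realizer ((\<lambda>r. Some (H' r)) \<circ>\<^sub>m (\<lambda>p. map_option (\<phi> p) ((G \<circ>\<^sub>m K) p))) (f\<^sup>\<D>)"
proof -
  define sol where "sol k q \<longleftrightarrow>
      (\<exists>x r y. src g k = Some x \<and> G k = Some r \<and> q \<le>\<^sub>T r \<and> tgt g q = Some y \<and> y \<in> vals g x)" for k q
  \<comment> \<open>The choice need not be effective: a reduction has to work for arbitrary
    realizers, so it applies to \<open>G'\<close>.\<close>
  define G' where "G' k = (if \<exists>q. sol k q then Some (SOME q. sol k q) else None)" for k
  have G': "sol k q" if "G' k = Some q" for k q
    using that someI_ex[of "sol k"] by (auto simp: G'_def split: if_splits)
  have "realizer G' g"
    unfolding realizer_def
  proof (intro allI impI)
    fix k x
    assume x: "src g k = Some x \<and> x \<in> mdom g"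
    moreover have "src (g\<^sup>\<D>) = src g"
      by (simp add: upper_cone_def)
    ultimately obtain r d where r: "G k = Some r" "tgt (g\<^sup>\<D>) r = Some d" "d \<in> vals (g\<^sup>\<D>) x"
      using G unfolding realizer_def mdom_upper_cone[OF g] by metis
    then obtain r' y q where "turing_deg r' = turing_deg r" "q \<le>\<^sub>T r'" "tgt g q = Some y" "y \<in> vals g x"
      by (auto simp: upper_cone_def deg_rep_def point_turing_le_def)
    moreover from this have "q \<le>\<^sub>T r"
      by (blast intro: turing_deg_eqD turing_le_trans)
    ultimately have "\<exists>q. sol k q"
      using x r(1) unfolding sol_def by blast
    then obtain q' where q': "G' k = Some q'"
      by (simp add: G'_def)
    with G'[OF q'] x show "\<exists>q y. G' k = Some q \<and> tgt g q = Some y \<and> y \<in> vals g x"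
      by (auto simp: sol_def)
  qed
  from red[OF this] have real: "realizer (H \<circ>\<^sub>m (\<lambda>p. map_option (\<phi> p) ((G' \<circ>\<^sub>m K) p))) f" .
  show ?thesis
    unfolding realizer_def mdom_upper_cone[OF f]
  proof (intro allI impI)
    fix p x
    assume "src (f\<^sup>\<D>) p = Some x \<and> x \<in> mdom f"
    then have "src f p = Some x" "x \<in> mdom f"
      by (simp_all add: upper_cone_def)
    with real obtain z y where z: "(H \<circ>\<^sub>m (\<lambda>p. map_option (\<phi> p) ((G' \<circ>\<^sub>m K) p))) p = Some z"
      and y: "tgt f z = Some y" "y \<in> vals f x"
      unfolding realizer_def by blast
    from z obtain k q where k: "K p = Some k" "G' k = Some q" "H (\<phi> p q) = Some z"
      by (auto simp: map_comp_Some_iff)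
    from G'[OF k(2)] obtain r where r: "G k = Some r" "q \<le>\<^sub>T r"
      unfolding sol_def by blast
    \<comment> \<open>The first argument p is the same on both sides, so only the replacement of q
      by r has to be monotone.\<close>
    have "z \<le>\<^sub>T H' (\<phi> p r)"
      by (rule H'[OF k(3) \<phi>[OF r(2)]])
    with y k(1) r(1) show "\<exists>q d. ((\<lambda>r. Some (H' r)) \<circ>\<^sub>m (\<lambda>p. map_option (\<phi> p) ((G \<circ>\<^sub>m K) p))) p
        = Some q \<and> tgt (f\<^sup>\<D>) q = Some d \<and> d \<in> vals (f\<^sup>\<D>) x"
      by (auto simp: upper_cone_def deg_rep_def point_turing_le_def)
  qed
qed

text \<open>The inner function K is kept. Assumption \<open>P\<close> supplies a total replacement
  for H within the same class whose output computes that of H, even from an input of higher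
  degree.\<close>

lemma W_le_via_upper_cone_mono:
  assumes "problem f" "problem g" "W_le_via P f g"
    and P: "\<And>H. P H \<Longrightarrow>
      \<exists>H'. P (\<lambda>r. Some (H' r)) \<and> (\<forall>q r z. H q = Some z \<longrightarrow> q \<le>\<^sub>T r \<longrightarrow> z \<le>\<^sub>T H' r)"
  shows "W_le_via P (f\<^sup>\<D>) (g\<^sup>\<D>)"
proof -
  obtain H K where HK: "P H" "P K"
    "\<And>G. realizer G g \<Longrightarrow> realizer (H \<circ>\<^sub>m (\<lambda>p. map_option (baire_pair p) ((G \<circ>\<^sub>m K) p))) f"
    using assms(3) unfolding W_le_via_def by blast
  from P[OF HK(1)] obtain H' where H': "P (\<lambda>r. Some (H' r))"
    "\<And>q r z. H q = Some z \<Longrightarrow> q \<le>\<^sub>T r \<Longrightarrow> z \<le>\<^sub>T H' r"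
    by blast
  show ?thesis
    unfolding W_le_via_def
  proof (intro exI conjI allI impI)
    show "P (\<lambda>r. Some (H' r))" and "P K"
      by (fact H'(1), fact HK(2))
    show "realizer ((\<lambda>r. Some (H' r)) \<circ>\<^sub>m (\<lambda>p. map_option (baire_pair p) ((G \<circ>\<^sub>m K) p))) (f\<^sup>\<D>)"
      if "realizer G (g\<^sup>\<D>)" for G
      by (rule realizer_upper_cone_reduction[OF assms(1,2) that HK(3) baire_pair_turing_mono H'(2)])
  qed
qed

lemma sW_le_via_upper_cone_mono:
  assumes "problem f" "problem g" "sW_le_via P f g"
    and P: "\<And>H. P H \<Longrightarrow>
      \<exists>H'. P (\<lambda>r. Some (H' r)) \<and> (\<forall>q r z. H q = Some z \<longrightarrow> q \<le>\<^sub>T r \<longrightarrow> z \<le>\<^sub>T H' r)"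
  shows "sW_le_via P (f\<^sup>\<D>) (g\<^sup>\<D>)"
proof -
  \<comment> \<open>Brings the parametrized composition, with the second projection as \<phi>, into
    the form used by \<open>sW_le_via\<close>.\<close>
  have assoc: "H \<circ>\<^sub>m (\<lambda>p. map_option (\<lambda>q. q) ((G \<circ>\<^sub>m K) p)) = H \<circ>\<^sub>m G \<circ>\<^sub>m K"
    for H G K :: "baire \<rightharpoonup> baire"
    by (auto simp: map_comp_def fun_eq_iff option.map_ident split: option.splits)
  obtain H K where HK: "P H" "P K" "\<And>G. realizer G g \<Longrightarrow> realizer (H \<circ>\<^sub>m G \<circ>\<^sub>m K) f"
    using assms(3) unfolding sW_le_via_def by blast
  from P[OF HK(1)] obtain H' where H': "P (\<lambda>r. Some (H' r))"
    "\<And>q r z. H q = Some z \<Longrightarrow> q \<le>\<^sub>T r \<Longrightarrow> z \<le>\<^sub>T H' r"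
    by blast
  show ?thesis
    unfolding sW_le_via_def
  proof (intro exI conjI allI impI)
    show "P (\<lambda>r. Some (H' r))" and "P K"
      by (fact H'(1), fact HK(2))
    show "realizer ((\<lambda>r. Some (H' r)) \<circ>\<^sub>m G \<circ>\<^sub>m K) (f\<^sup>\<D>)" if "realizer G (g\<^sup>\<D>)" for G
      by (rule realizer_upper_cone_reduction[where \<phi> = "\<lambda>p q. q", unfolded assoc,
            OF assms(1,2) that HK(3) _ H'(2)])
  qed
qed

lemma computable_pfun_turing_mono:
  assumes "computable_pfun H"
  shows "\<exists>H'. computable_pfun (\<lambda>r. Some (H' r)) \<and>
    (\<forall>q r z. H q = Some z \<longrightarrow> q \<le>\<^sub>T r \<longrightarrow> z \<le>\<^sub>T H' r)"
proof (intro exI conjI allI impI)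
  \<comment> \<open>This goal fixes the witness \<open>H'\<close> as the identity.\<close>
  show "computable_pfun (\<lambda>r. Some r)"
    by (rule computable_pfun_Some)
  show "z \<le>\<^sub>T r" if "H q = Some z" "q \<le>\<^sub>T r" for q r z
    using assms that turing_le_trans unfolding computable_pfun_def turing_le_def by meson
qed

text \<open>The witness is pairing with the oracle s: z is Turing below \<open><s, q>\<close>, which
  is Turing below \<open><s, r>\<close>.\<close>

lemma continuous_pfun_turing_mono:
  assumes "continuous_pfun H"
  shows "\<exists>H'. continuous_pfun (\<lambda>r. Some (H' r)) \<and>
    (\<forall>q r z. H q = Some z \<longrightarrow> q \<le>\<^sub>T r \<longrightarrow> z \<le>\<^sub>T H' r)"
proof -
  obtain s where "\<And>p z. H p = Some z \<Longrightarrow> z \<le>\<^sub>T baire_pair s p"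
    using continuous_pfun_turing_le[OF assms] by blast
  then have "\<forall>q r z. H q = Some z \<longrightarrow> q \<le>\<^sub>T r \<longrightarrow> z \<le>\<^sub>T baire_pair s r"
    using baire_pair_turing_mono turing_le_trans by blast
  then show ?thesis
    using continuous_pfun_baire_pair by blast
qed

theorem proposition4p4:
  fixes f :: "('a, 'b) mvfun" and g :: "('c, 'd) mvfun"
  assumes "problem f" and "problem g"
  shows
    "(f\<^sup>\<D> \<le>\<^sub>s\<^sub>W f \<and> (f \<le>\<^sub>s\<^sub>W g \<longrightarrow> f\<^sup>\<D> \<le>\<^sub>s\<^sub>W g\<^sup>\<D>) \<and> f\<^sup>\<D> \<le>\<^sub>s\<^sub>W (f\<^sup>\<D>)\<^sup>\<D>) \<and>
     (f\<^sup>\<D> \<le>\<^sub>W f \<and> (f \<le>\<^sub>W g \<longrightarrow> f\<^sup>\<D> \<le>\<^sub>W g\<^sup>\<D>) \<and> f\<^sup>\<D> \<le>\<^sub>W (f\<^sup>\<D>)\<^sup>\<D>) \<and>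
     (f\<^sup>\<D> \<le>\<^sub>W\<^sup>* f \<and> (f \<le>\<^sub>W\<^sup>* g \<longrightarrow> f\<^sup>\<D> \<le>\<^sub>W\<^sup>* g\<^sup>\<D>) \<and> f\<^sup>\<D> \<le>\<^sub>W\<^sup>* (f\<^sup>\<D>)\<^sup>\<D>) \<and>
     (f\<^sup>\<D> \<le>\<^sub>s\<^sub>W\<^sup>* f \<and> (f \<le>\<^sub>s\<^sub>W\<^sup>* g \<longrightarrow> f\<^sup>\<D> \<le>\<^sub>s\<^sub>W\<^sup>* g\<^sup>\<D>) \<and> f\<^sup>\<D> \<le>\<^sub>s\<^sub>W\<^sup>* (f\<^sup>\<D>)\<^sup>\<D>)"
  unfolding sW_le_def W_le_def W_le_cont_def sW_le_cont_def
  by (intro conjI impI)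
    (blast intro: assms sW_le_via_realizer W_le_via_realizer
      realizer_upper_cone realizer_upper_cone_iterated
      sW_le_via_upper_cone_mono W_le_via_upper_cone_mono
      computable_pfun_Some computable_pfun_baire_snd computable_pfun_turing_mono
      continuous_pfun_Some continuous_pfun_baire_snd continuous_pfun_turing_mono)+

end
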